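(* Let $\mathcal{B}$ be a complete Boolean algebra with the Stone space $Q$, and let $X$ be an ideal in $C(Q)$. For a derivation $\delta\colon X\to L^0(\mathcal{B})$ the following conditions are equivalent: (i) $\delta$ is a band preserving derivation, i.e. $s(\delta(x))\leqslant s(x)$ for all $x\in X$. (ii) $s(\delta)\leqslant s(X)$.
   Context: $L^0(\mathcal{B}):=C_\infty(Q)$ denotes the set of all continuous functions $x:Q\to[-\infty,+\infty]$ taking the values $\pm\infty$ at most on a nowhere dense set; with the usual operations (pointwise on a dense open set, extended by continuity) and pointwise order it is a commutative real algebra and a universally complete vector lattice. $C(Q)\subset L^0(\mathcal{B})$ is the subalgebra of continuous real-valued functions. $\mathcal{B}$ is identified with the Boolean algebra of idempotents of $L^0(\mathcal{B})$ (characteristic functions of clopen sets); $\mathbf{1}$ is the constant function one. Support: for $x\in L^0(\mathcal{B})$, $s(x)=\mathbf{1}-\sup\{e\in\mathcal{B}:ex=0\}\in\mathcal{B}$; for non-empty $E\subset L^0(\mathcal{B})$, $s(E)=\sup\{s(x):x\in E\}$; for a derivation, $s(\delta)=\sup\{s(\delta(x)):x\in X\}$. An ideal in $C(Q)$ is a subalgebra $X\subset C(Q)$ with $xa\in X$ for all $x\in C(Q)$, $a\in X$. A derivation $\delta:X\to L^0(\mathcal{B})$ is a linear map with $\delta(xy)=\delta(x)y+x\delta(y)$ for all $x,y\in X$. *)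

theory Defs
  imports "HOL-Analysis.Analysis"
begin

text \<open>
  A complete Boolean algebra is a type of sort \<open>{boolean_algebra, complete_lattice}\<close>.
  The library class \<open>complete_boolean_algebra\<close> must not be used here: it demands complete
  distributivity, which forces the algebra to be atomic.
\<close>

section \<open>The Stone space\<close>

definition ultrafilter :: "'b::boolean_algebra set \<Rightarrow> bool" where
  "ultrafilter U \<longleftrightarrow>
     top \<in> U \<and> bot \<notin> U \<and>
     (\<forall>a b. a \<in> U \<longrightarrow> b \<in> U \<longrightarrow> inf a b \<in> U) \<and>
     (\<forall>a b. a \<in> U \<longrightarrow> a \<le> b \<longrightarrow> b \<in> U) \<and>
     (\<forall>a. a \<in> U \<or> - a \<in> U)"

definition stone_clopen :: "'b::boolean_algebra \<Rightarrow> 'b set set" where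
  "stone_clopen a = {U. ultrafilter U \<and> a \<in> U}"

definition stone_space :: "'b::boolean_algebra set topology" where
  "stone_space = topology_generated_by (range stone_clopen)"

lemma topspace_stone_space: "topspace stone_space = Collect ultrafilter"
  by (auto simp: stone_space_def stone_clopen_def ultrafilter_def)

lemma openin_stone_clopen: "openin stone_space (stone_clopen a)"
  by (simp add: stone_space_def topology_generated_by_Basis)

section \<open>The space of extended continuous functions\<close>

definition nowhere_dense_in :: "'a topology \<Rightarrow> 'a set \<Rightarrow> bool" where
  "nowhere_dense_in T S \<longleftrightarrow> S \<subseteq> topspace T \<and> T interior_of (T closure_of S) = {}"

definition dense_open_in :: "'a topology \<Rightarrow> 'a set \<Rightarrow> bool" where
  "dense_open_in T D \<longleftrightarrow> openin T D \<and> T closure_of D = topspace T"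

text \<open>
  Extensionality makes equality in the type \<open>'b L0\<close> below coincide with equality of functions
  on the Stone space.
\<close>

definition C_infinity :: "('b::{boolean_algebra, complete_lattice} set \<Rightarrow> ereal) set" where
  "C_infinity = {f \<in> extensional (topspace stone_space).
     continuous_map stone_space euclidean f \<and>
     nowhere_dense_in stone_space {q \<in> topspace stone_space. \<bar>f q\<bar> = \<infinity>}}"

lemma indicator_in_C_infinity:
  "(\<lambda>q\<in>topspace stone_space. if e \<in> q then 1 else 0)
     \<in> (C_infinity :: ('b::{boolean_algebra, complete_lattice} set \<Rightarrow> ereal) set)"
proof -
  let ?Q = "stone_space :: 'b set topology"
  let ?f = "\<lambda>q\<in>topspace ?Q. if e \<in> q then 1 else (0::ereal)"
  have compl: "topspace ?Q - stone_clopen e = stone_clopen (- e)"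
  proof -
    have "\<not> (e \<in> U \<and> - e \<in> U)" if "ultrafilter U" for U :: "'b set"
      using that unfolding ultrafilter_def by (metis inf_compl_bot)
    moreover have "e \<in> U \<or> - e \<in> U" if "ultrafilter U" for U :: "'b set"
      using that by (simp add: ultrafilter_def)
    ultimately show ?thesis
      by (auto simp: topspace_stone_space stone_clopen_def)
  qed
  have "openin ?Q {q \<in> topspace ?Q. ?f q \<in> V}" for V
  proof -
    have "{q \<in> topspace ?Q. ?f q \<in> V} =
        (if 1 \<in> V then stone_clopen e else {}) \<union> (if 0 \<in> V then topspace ?Q - stone_clopen e else {})"
      by (auto simp: topspace_stone_space stone_clopen_def)
    then show ?thesis
      by (simp add: compl openin_stone_clopen openin_Un)
  qed
  then have "continuous_map ?Q euclidean ?f"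
    by (simp add: continuous_map_def)
  moreover have "{q \<in> topspace ?Q. \<bar>?f q\<bar> = \<infinity>} = {}"
    by auto
  ultimately show ?thesis
    by (simp add: C_infinity_def nowhere_dense_in_def)
qed

typedef (overloaded) 'b L0 = "C_infinity :: ('b::{boolean_algebra, complete_lattice} set \<Rightarrow> ereal) set"
  morphisms L0_fun Abs_L0
  using indicator_in_C_infinity by blast

text \<open>
  The identification of the Boolean algebra with the idempotents of \<open>'b L0\<close>:
  an element is sent to the characteristic function of its clopen set.
\<close>

definition idem :: "'b::{boolean_algebra, complete_lattice} \<Rightarrow> 'b L0" where
  "idem e = Abs_L0 (\<lambda>q\<in>topspace stone_space. if e \<in> q then 1 else 0)"

text \<open>
  The operations are pointwise on a dense open set on which the arguments are finite. The element
  described by \<open>THE\<close> exists because the Stone space of a complete Boolean algebra is extremally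
  disconnected, and is unique because continuous functions into a Hausdorff space that agree on a
  dense set are equal.
\<close>

instantiation L0 :: ("{boolean_algebra, complete_lattice}") "{zero, plus, times, scaleR}"
begin

definition zero_L0 :: "'a L0" where
  "0 = Abs_L0 (\<lambda>q\<in>topspace stone_space. 0)"

definition plus_L0 :: "'a L0 \<Rightarrow> 'a L0 \<Rightarrow> 'a L0" where
  "x + y = (THE z. \<exists>D. dense_open_in stone_space D \<and>
     (\<forall>q\<in>D. \<bar>L0_fun x q\<bar> \<noteq> \<infinity> \<and> \<bar>L0_fun y q\<bar> \<noteq> \<infinity> \<and> L0_fun z q = L0_fun x q + L0_fun y q))"

definition times_L0 :: "'a L0 \<Rightarrow> 'a L0 \<Rightarrow> 'a L0" where
  "x * y = (THE z. \<exists>D. dense_open_in stone_space D \<and>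
     (\<forall>q\<in>D. \<bar>L0_fun x q\<bar> \<noteq> \<infinity> \<and> \<bar>L0_fun y q\<bar> \<noteq> \<infinity> \<and> L0_fun z q = L0_fun x q * L0_fun y q))"

definition scaleR_L0 :: "real \<Rightarrow> 'a L0 \<Rightarrow> 'a L0" where
  "c *\<^sub>R x = (THE z. \<exists>D. dense_open_in stone_space D \<and>
     (\<forall>q\<in>D. \<bar>L0_fun x q\<bar> \<noteq> \<infinity> \<and> L0_fun z q = ereal c * L0_fun x q))"

instance ..

end

definition CQ :: "'b::{boolean_algebra, complete_lattice} L0 set" where
  "CQ = {x. \<forall>q\<in>topspace stone_space. \<bar>L0_fun x q\<bar> \<noteq> \<infinity>}"

section \<open>Supports\<close>

definition supp :: "'b::{boolean_algebra, complete_lattice} L0 \<Rightarrow> 'b" where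
  "supp x = top - Sup {e. idem e * x = 0}"

definition supp_set :: "'b::{boolean_algebra, complete_lattice} L0 set \<Rightarrow> 'b" where
  "supp_set E = Sup (supp ` E)"

section \<open>Ideals and derivations\<close>

definition subalgebra :: "'b::{boolean_algebra, complete_lattice} L0 set \<Rightarrow> bool" where
  "subalgebra X \<longleftrightarrow>
     0 \<in> X \<and> (\<forall>x\<in>X. \<forall>y\<in>X. x + y \<in> X) \<and> (\<forall>c. \<forall>x\<in>X. c *\<^sub>R x \<in> X) \<and>
     (\<forall>x\<in>X. \<forall>y\<in>X. x * y \<in> X)"

definition ideal_in_CQ :: "'b::{boolean_algebra, complete_lattice} L0 set \<Rightarrow> bool" where
  "ideal_in_CQ X \<longleftrightarrow> X \<subseteq> CQ \<and> subalgebra X \<and> (\<forall>x\<in>CQ. \<forall>a\<in>X. x * a \<in> X)"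

text \<open>
  A map defined on \<open>X\<close> is represented by a total function; only its values on \<open>X\<close> are used.
\<close>

definition derivation_on ::
  "'b::{boolean_algebra, complete_lattice} L0 set \<Rightarrow> ('b L0 \<Rightarrow> 'b L0) \<Rightarrow> bool" where
  "derivation_on X \<delta> \<longleftrightarrow>
     (\<forall>x\<in>X. \<forall>y\<in>X. \<delta> (x + y) = \<delta> x + \<delta> y) \<and>
     (\<forall>c. \<forall>x\<in>X. \<delta> (c *\<^sub>R x) = c *\<^sub>R \<delta> x) \<and>
     (\<forall>x\<in>X. \<forall>y\<in>X. \<delta> (x * y) = \<delta> x * y + x * \<delta> y)"

definition supp_derivation ::
  "'b::{boolean_algebra, complete_lattice} L0 set \<Rightarrow> ('b L0 \<Rightarrow> 'b L0) \<Rightarrow> 'b" where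
  "supp_derivation X \<delta> = Sup {supp (\<delta> x) |x. x \<in> X}"

definition band_preserving ::
  "'b::{boolean_algebra, complete_lattice} L0 set \<Rightarrow> ('b L0 \<Rightarrow> 'b L0) \<Rightarrow> bool" where
  "band_preserving X \<delta> \<longleftrightarrow> (\<forall>x\<in>X. supp (\<delta> x) \<le> supp x)"

end

theory Submission
  imports Defs
begin

text \<open>
  A derivation can only create support outside \<open>s(x)\<close> where every element of \<open>X\<close> vanishes; this is
  because \<open>X\<close> contains many idempotents and derivations kill idempotents.

  From band preserving to the inequality of supports one takes suprema over \<open>X\<close>.

  For the converse it suffices that \<open>e x = 0\<close> implies \<open>e \<delta>(x) = 0\<close> for every idempotent \<open>e\<close>, since
  both supports are complements of suprema of such \<open>e\<close>. Suppose that \<open>\<delta>(x)\<close> is nonzero at a point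
  of \<open>e\<close>. Then it is nonzero on a whole clopen set \<open>f \<le> e\<close> around that point, so
  \<open>f \<le> s(\<delta>(x)) \<le> s(\<delta>) \<le> s(X)\<close>. Hence some \<open>a \<in> X\<close> is nonzero at a point of \<open>f\<close>, and then on a clopen
  neighbourhood \<open>k \<le> f\<close> of that point. On \<open>k\<close> the function \<open>a\<close> has a continuous finite inverse, so
  the idempotent \<open>k\<close> is a multiple of \<open>a\<close> and lies in \<open>X\<close> (\<open>idem_in_ideal\<close>). Being idempotent,
  it satisfies \<open>\<delta>(k) = 0\<close> (\<open>derivation_on_idem\<close>), so \<open>0 = \<delta>(k x) = \<delta>(k) x + k \<delta>(x) = k \<delta>(x)\<close>
  (\<open>idem_times_derivation_eq_0\<close>), although \<open>\<delta>(x)\<close> vanishes nowhere on \<open>k \<le> f\<close>.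

  Working with idempotents keeps the algebra elementary: each sum or product that has to be
  computed has a value given by a formula that is continuous on the whole Stone space (an argument
  cut off to a clopen set, a product of finite functions, a doubled function). Such a value is
  the sum or product because continuous functions are determined on a dense open set.
\<close>

section \<open>Clopen sets of the Stone space\<close>

lemma compl_mem_ultrafilter_iff: "ultrafilter U \<Longrightarrow> - a \<in> U \<longleftrightarrow> a \<notin> U"
  unfolding ultrafilter_def by (metis inf_compl_bot)

lemma inf_mem_ultrafilter_iff: "ultrafilter U \<Longrightarrow> inf a b \<in> U \<longleftrightarrow> a \<in> U \<and> b \<in> U"
  unfolding ultrafilter_def by (meson inf_le1 inf_le2)

lemma ultrafilter_mono: "ultrafilter U \<Longrightarrow> a \<in> U \<Longrightarrow> a \<le> b \<Longrightarrow> b \<in> U"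
  unfolding ultrafilter_def by blast

lemma bot_notin_ultrafilter: "ultrafilter U \<Longrightarrow> bot \<notin> U"
  unfolding ultrafilter_def by blast

text \<open>
  By Zorn's lemma there is a maximal proper filter \<open>M\<close> containing \<open>b\<close>. If \<open>- a\<close> is not in \<open>M\<close>, then \<open>M\<close> and
  \<open>a\<close> together still generate a proper filter, which by maximality is \<open>M\<close>, so \<open>a\<close> is in \<open>M\<close>.
\<close>
lemma ultrafilter_exists:
  fixes b :: "'b::boolean_algebra"
  assumes "b \<noteq> bot"
  obtains U where "ultrafilter U" and "b \<in> U"
proof -
  define \<F> where "\<F> = {F. b \<in> F \<and> bot \<notin> F \<and> (\<forall>x\<in>F. \<forall>y\<in>F. inf x y \<in> F) \<and>
    (\<forall>x\<in>F. \<forall>y. x \<le> y \<longrightarrow> y \<in> F)}"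
  have "\<exists>M\<in>\<F>. \<forall>N\<in>\<F>. M \<subseteq> N \<longrightarrow> N = M"
  proof (rule subset_Zorn_nonempty)
    have "{x. b \<le> x} \<in> \<F>"
      using assms by (auto simp: \<F>_def le_bot intro: order_trans)
    then show "\<F> \<noteq> {}" by blast
  next
    fix C assume C: "C \<noteq> {}" "subset.chain \<F> C"
    have sub: "F \<in> \<F>" if "F \<in> C" for F
      using C that by (auto simp: subset.chain_def)
    have "inf x y \<in> \<Union>C" if xy: "x \<in> \<Union>C" "y \<in> \<Union>C" for x y
    proof -
      obtain F where "F \<in> C" "x \<in> F" "y \<in> F"
        using xy C unfolding subset_chain_def by blast
      then show ?thesis using sub unfolding \<F>_def by blast
    qed
    moreover have "y \<in> \<Union>C" if "x \<in> \<Union>C" "x \<le> y" for x y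
      using that sub unfolding \<F>_def by blast
    moreover have "b \<in> \<Union>C" and "bot \<notin> \<Union>C"
      using C sub unfolding \<F>_def by blast+
    ultimately show "\<Union>C \<in> \<F>"
      by (auto simp: \<F>_def)
  qed
  then obtain M where M: "M \<in> \<F>" and max: "\<And>N. N \<in> \<F> \<Longrightarrow> M \<subseteq> N \<Longrightarrow> N = M"
    by blast
  have inf_M: "\<And>x y. x \<in> M \<Longrightarrow> y \<in> M \<Longrightarrow> inf x y \<in> M"
    and up_M: "\<And>x y. x \<in> M \<Longrightarrow> x \<le> y \<Longrightarrow> y \<in> M" and M_bot: "b \<in> M" "bot \<notin> M"
    using M by (auto simp: \<F>_def)
  have "a \<in> M" if a: "- a \<notin> M" for a
  proof -
    let ?N = "{c. \<exists>m\<in>M. inf m a \<le> c}"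
    have "bot \<notin> ?N"
    proof
      assume "bot \<in> ?N"
      then obtain m where "m \<in> M" "inf m a = bot" by (auto simp: le_bot)
      then show False using a up_M by (metis inf_shunt)
    qed
    moreover have "inf x y \<in> ?N" if xy: "x \<in> ?N" "y \<in> ?N" for x y
    proof -
      obtain m n where mn: "m \<in> M" "n \<in> M" "inf m a \<le> x" "inf n a \<le> y"
        using xy by blast
      have "inf (inf m n) a \<le> inf (inf m a) (inf n a)"
        by (simp add: le_infI1 le_infI2)
      also have "\<dots> \<le> inf x y" using mn by (intro inf_mono)
      finally show ?thesis using inf_M mn by blast
    qed
    moreover have sub: "M \<subseteq> ?N" by (auto intro: le_infI1)
    ultimately have "?N \<in> \<F>"
      using M_bot by (auto simp: \<F>_def intro: order_trans)
    then have "?N = M" using sub max by blast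
    moreover have "a \<in> ?N" using M_bot by (auto intro!: bexI[of _ b])
    ultimately show ?thesis by blast
  qed
  then have "ultrafilter M"
    unfolding ultrafilter_def using inf_M up_M M_bot top_greatest by blast
  then show ?thesis using that M_bot by blast
qed

text \<open>
  The clopen sets are given as a subbase. They are closed under finite intersections, because
  \<open>inf\<close> corresponds to intersection, so they already form a base.
\<close>
lemma stone_space_clopen_base:
  assumes "openin stone_space W" and "q \<in> W"
  obtains a where "a \<in> q" and "stone_clopen a \<subseteq> W"
proof -
  have "generate_topology_on (range stone_clopen) W"
    using assms(1) by (simp add: stone_space_def openin_topology_generated_by_iff)
  then have "\<forall>q\<in>W. \<exists>a\<in>q. stone_clopen a \<subseteq> W"
  proof induction
    case (Int V W)
    show ?case
    proof
      fix q assume "q \<in> V \<inter> W"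
      then obtain a b where a: "a \<in> q" "stone_clopen a \<subseteq> V" and b: "b \<in> q" "stone_clopen b \<subseteq> W"
        using Int.IH by blast
      have "ultrafilter q"
        using Int.hyps \<open>q \<in> V \<inter> W\<close> topspace_stone_space
        by (metis IntD1 mem_Collect_eq openin_subset openin_topology_generated_by_iff
            stone_space_def subset_iff)
      then have "inf a b \<in> q"
        using a b by (simp add: inf_mem_ultrafilter_iff)
      moreover have "stone_clopen (inf a b) \<subseteq> V \<inter> W"
        using a b by (auto simp: stone_clopen_def inf_mem_ultrafilter_iff)
      ultimately show "\<exists>a\<in>q. stone_clopen a \<subseteq> V \<inter> W" by blast
    qed
  next
    case (UN K)
    then show ?case by (meson Union_iff Union_upper order_trans)
  next
    case (Basis s)
    then show ?case by (auto simp: stone_clopen_def)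
  qed auto
  then show ?thesis using assms(2) that by blast
qed

text \<open>
  The function is pasted together from \<open>g\<close> and \<open>0\<close> along a clopen set and its open complement.
\<close>
lemma continuous_map_extend_by_zero:
  fixes g :: "'b::boolean_algebra set \<Rightarrow> ereal"
  assumes "continuous_map (subtopology stone_space (stone_clopen e)) euclidean g"
  shows "continuous_map stone_space euclidean (\<lambda>q. if e \<in> q then g q else 0)"
proof -
  have "openin stone_space {q \<in> topspace stone_space. (if e \<in> q then g q else 0) \<in> V}" (is "openin _ ?P")
    if "open V" for V
  proof -
    have top: "topspace (subtopology stone_space (stone_clopen e)) = stone_clopen e"
      by (auto simp: topspace_stone_space stone_clopen_def)
    have "openin (subtopology stone_space (stone_clopen e)) {q \<in> stone_clopen e. g q \<in> V}"
      using assms that unfolding continuous_map_def top by auto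
    then have "openin stone_space {q \<in> stone_clopen e. g q \<in> V}"
      using openin_stone_clopen openin_open_subtopology by blast
    moreover have "?P = {q \<in> stone_clopen e. g q \<in> V} \<union> (if 0 \<in> V then stone_clopen (- e) else {})"
      by (auto simp: topspace_stone_space stone_clopen_def compl_mem_ultrafilter_iff)
    ultimately show ?thesis
      by (auto simp: openin_stone_clopen)
  qed
  then show ?thesis by (simp add: continuous_map_def)
qed

section \<open>Elements of the algebra as functions\<close>

lemma L0_fun_in_C_infinity: "L0_fun x \<in> C_infinity"
  by (rule L0_fun)

lemma continuous_map_L0_fun: "continuous_map stone_space euclidean (L0_fun x)"
  using L0_fun_in_C_infinity[of x] by (simp add: C_infinity_def)

definition finite_points :: "'b::{boolean_algebra, complete_lattice} L0 \<Rightarrow> 'b set set" where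
  "finite_points x = {q \<in> topspace stone_space. \<bar>L0_fun x q\<bar> \<noteq> \<infinity>}"

lemma dense_open_in_finite_points: "dense_open_in stone_space (finite_points x)"
proof -
  let ?I = "{q \<in> topspace stone_space. \<bar>L0_fun x q\<bar> = \<infinity>}"
  have eq: "finite_points x = {q \<in> topspace stone_space. L0_fun x q \<in> - {\<infinity>, -\<infinity>}}"
    by (auto simp: finite_points_def)
  have op: "openin stone_space (finite_points x)"
    unfolding eq by (rule openin_continuous_map_preimage[OF continuous_map_L0_fun]) auto
  have compl: "?I = topspace stone_space - finite_points x"
    by (auto simp: finite_points_def)
  have "stone_space interior_of ?I = {}"
  proof -
    have "stone_space interior_of (stone_space closure_of ?I) = {}"
      using L0_fun_in_C_infinity[of x] by (simp add: C_infinity_def nowhere_dense_in_def)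
    moreover have "stone_space interior_of ?I \<subseteq> stone_space interior_of (stone_space closure_of ?I)"
      by (intro interior_of_mono closure_of_subset) auto
    ultimately show ?thesis by blast
  qed
  then have "stone_space closure_of (finite_points x) = topspace stone_space"
    unfolding compl by (simp add: interior_of_complement closure_of_subset_topspace subset_antisym)
  with op show ?thesis by (simp add: dense_open_in_def)
qed

lemma dense_open_in_Int:
  "dense_open_in T D \<Longrightarrow> dense_open_in T E \<Longrightarrow> dense_open_in T (D \<inter> E)"
  unfolding dense_open_in_def
  by (metis closure_of_openin_Int_closure_of openin_Int openin_subset inf.absorb1)

lemma L0_eqI:
  assumes "dense_open_in stone_space D" and "\<And>q. q \<in> D \<Longrightarrow> L0_fun x q = L0_fun y q"
  shows "x = y"
proof -
  have "L0_fun x q = L0_fun y q" for q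
  proof (cases "q \<in> topspace stone_space")
    case True
    then have "q \<in> stone_space closure_of D"
      using assms(1) by (simp add: dense_open_in_def)
    then show ?thesis
    proof (rule forall_in_closure_of_eq)
      show "Hausdorff_space (euclidean :: ereal topology)"
        unfolding Hausdorff_space_def disjnt_def by (simp, metis hausdorff)
    qed (auto intro: continuous_map_L0_fun assms(2))
  next
    case False
    then show ?thesis
      using L0_fun_in_C_infinity[of x] L0_fun_in_C_infinity[of y]
      by (simp add: C_infinity_def extensional_def)
  qed
  then show ?thesis by (metis L0_fun_inject ext)
qed

text \<open>
  The common form of the three operations: \<open>P\<close> says that the arguments are finite and \<open>h\<close> computes
  the pointwise value. Two candidates agree on an intersection of two dense open sets, which is
  again dense, so a single candidate determines the value of the description.
\<close>
lemma L0_eq_THE: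
  assumes D: "dense_open_in stone_space D" and z: "\<And>q. q \<in> D \<Longrightarrow> P q \<and> L0_fun z q = h q"
  shows "(THE z. \<exists>D. dense_open_in stone_space D \<and> (\<forall>q\<in>D. P q \<and> L0_fun z q = h q)) = z"
proof (rule the_equality)
  show "\<exists>D. dense_open_in stone_space D \<and> (\<forall>q\<in>D. P q \<and> L0_fun z q = h q)"
    using assms by blast
next
  fix w assume "\<exists>D. dense_open_in stone_space D \<and> (\<forall>q\<in>D. P q \<and> L0_fun w q = h q)"
  then obtain E where "dense_open_in stone_space E" and "\<And>q. q \<in> E \<Longrightarrow> P q \<and> L0_fun w q = h q"
    by blast
  then show "w = z"
    using D z by (intro L0_eqI[OF dense_open_in_Int[of _ D E]]) auto
qed

lemma finite_points_iff: "q \<in> finite_points x \<longleftrightarrow> ultrafilter q \<and> \<bar>L0_fun x q\<bar> \<noteq> \<infinity>"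
  by (simp add: finite_points_def topspace_stone_space)

lemma ultrafilter_finite_points: "q \<in> finite_points x \<Longrightarrow> ultrafilter q"
  by (simp add: finite_points_iff)

lemma L0_plus_eqI:
  assumes "\<And>q. q \<in> finite_points x \<Longrightarrow> q \<in> finite_points y \<Longrightarrow> L0_fun z q = L0_fun x q + L0_fun y q"
  shows "x + y = z"
proof -
  have "dense_open_in stone_space (finite_points x \<inter> finite_points y)"
    by (intro dense_open_in_Int dense_open_in_finite_points)
  then show ?thesis
    unfolding plus_L0_def conj_assoc[symmetric]
  proof (rule L0_eq_THE)
    fix q assume "q \<in> finite_points x \<inter> finite_points y"
    then show "(\<bar>L0_fun x q\<bar> \<noteq> \<infinity> \<and> \<bar>L0_fun y q\<bar> \<noteq> \<infinity>) \<and> L0_fun z q = L0_fun x q + L0_fun y q"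
      using assms[of q] by (simp only: Int_iff finite_points_iff) blast
  qed
qed

lemma L0_times_eqI:
  assumes "\<And>q. q \<in> finite_points x \<Longrightarrow> q \<in> finite_points y \<Longrightarrow> L0_fun z q = L0_fun x q * L0_fun y q"
  shows "x * y = z"
proof -
  have "dense_open_in stone_space (finite_points x \<inter> finite_points y)"
    by (intro dense_open_in_Int dense_open_in_finite_points)
  then show ?thesis
    unfolding times_L0_def conj_assoc[symmetric]
  proof (rule L0_eq_THE)
    fix q assume "q \<in> finite_points x \<inter> finite_points y"
    then show "(\<bar>L0_fun x q\<bar> \<noteq> \<infinity> \<and> \<bar>L0_fun y q\<bar> \<noteq> \<infinity>) \<and> L0_fun z q = L0_fun x q * L0_fun y q"
      using assms[of q] by (simp only: Int_iff finite_points_iff) blast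
  qed
qed

lemma L0_scaleR_eqI:
  assumes "\<And>q. q \<in> finite_points x \<Longrightarrow> L0_fun z q = ereal c * L0_fun x q"
  shows "c *\<^sub>R x = z"
  unfolding scaleR_L0_def using dense_open_in_finite_points[of x]
proof (rule L0_eq_THE)
  fix q assume "q \<in> finite_points x"
  then show "\<bar>L0_fun x q\<bar> \<noteq> \<infinity> \<and> L0_fun z q = ereal c * L0_fun x q"
    using assms[of q] by (simp only: finite_points_iff) blast
qed

text \<open>
  The bound \<open>y\<close> controls infinite values: the points where \<open>h\<close> is infinite lie in the
  corresponding set for \<open>y\<close>, which is nowhere dense.
\<close>
lemma L0_obtain:
  fixes h :: "'b::{boolean_algebra, complete_lattice} set \<Rightarrow> ereal" and y :: "'b L0"
  assumes h: "continuous_map stone_space euclidean h"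
    and fin: "\<And>q. q \<in> finite_points y \<Longrightarrow> \<bar>h q\<bar> \<noteq> \<infinity>"
  obtains z :: "'b L0" where "\<And>q. ultrafilter q \<Longrightarrow> L0_fun z q = h q"
proof -
  let ?h = "restrict h (topspace stone_space)"
  let ?I = "{q \<in> topspace stone_space. \<bar>?h q\<bar> = \<infinity>}"
  let ?J = "{q \<in> topspace stone_space. \<bar>L0_fun y q\<bar> = \<infinity>}"
  have sub: "?I \<subseteq> ?J"
  proof
    fix q assume q: "q \<in> ?I"
    then have qQ: "q \<in> topspace stone_space" by blast
    have "\<bar>h q\<bar> = \<infinity>" using q unfolding mem_Collect_eq restrict_apply'[OF qQ] by blast
    then show "q \<in> ?J"
      using qQ fin[of q] unfolding finite_points_iff mem_Collect_eq topspace_stone_space by argo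
  qed
  have "stone_space interior_of (stone_space closure_of ?J) = {}"
    using L0_fun_in_C_infinity[of y] by (simp add: C_infinity_def nowhere_dense_in_def)
  then have "stone_space interior_of (stone_space closure_of ?I) = {}"
    using interior_of_mono[OF closure_of_mono[OF sub, of stone_space], of stone_space] by blast
  then have "nowhere_dense_in stone_space ?I"
    unfolding nowhere_dense_in_def by (intro conjI Collect_restrict)
  moreover have "continuous_map stone_space euclidean ?h"
    using h by (rule continuous_map_eq) simp
  ultimately have "?h \<in> C_infinity"
    unfolding C_infinity_def by (intro CollectI conjI restrict_extensional)
  then have "L0_fun (Abs_L0 ?h) = ?h" by (rule Abs_L0_inverse)
  then have "L0_fun (Abs_L0 ?h) q = h q" if "ultrafilter q" for q
    using that by (metis topspace_stone_space mem_Collect_eq restrict_apply')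
  then show ?thesis by (rule that)
qed

lemma L0_fun_idem:
  fixes e :: "'b::{boolean_algebra, complete_lattice}"
  assumes "ultrafilter q"
  shows "L0_fun (idem e) q = (if e \<in> q then 1 else 0)"
proof -
  have "q \<in> topspace stone_space" using assms by (simp add: topspace_stone_space)
  then show ?thesis
    unfolding idem_def Abs_L0_inverse[OF indicator_in_C_infinity] by simp
qed

lemma zero_L0_eq_idem: "0 = idem bot"
  unfolding zero_L0_def idem_def
  by (rule arg_cong[of _ _ Abs_L0]) (auto simp: topspace_stone_space bot_notin_ultrafilter)

lemma L0_fun_zero: "ultrafilter q \<Longrightarrow> L0_fun 0 q = 0"
  by (simp add: zero_L0_eq_idem L0_fun_idem bot_notin_ultrafilter)

lemma CQ_iff: "x \<in> CQ \<longleftrightarrow> (\<forall>q. ultrafilter q \<longrightarrow> \<bar>L0_fun x q\<bar> \<noteq> \<infinity>)"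
  by (simp add: CQ_def topspace_stone_space)

lemma L0_zeroI: "(\<And>q. q \<in> finite_points x \<Longrightarrow> L0_fun x q = 0) \<Longrightarrow> x = 0"
  by (rule L0_eqI[OF dense_open_in_finite_points[of x]]) (simp add: L0_fun_zero ultrafilter_finite_points)

lemma L0_fun_idem_times:
  assumes "ultrafilter q"
  shows "L0_fun (idem e * y) q = (if e \<in> q then L0_fun y q else 0)"
proof -
  have "continuous_map stone_space euclidean (\<lambda>q. if e \<in> q then L0_fun y q else 0)"
    by (intro continuous_map_extend_by_zero continuous_map_from_subtopology continuous_map_L0_fun)
  then obtain z where z: "\<And>q. ultrafilter q \<Longrightarrow> L0_fun z q = (if e \<in> q then L0_fun y q else 0)"
    by (rule L0_obtain[where y = y]) (auto simp: finite_points_iff)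
  have "idem e * y = z"
    by (rule L0_times_eqI) (simp add: z L0_fun_idem ultrafilter_finite_points)
  with assms z show ?thesis by simp
qed

text \<open>
  Translates the annihilators in the definition of supports into vanishing at every point of a
  clopen set, with no exceptional nowhere dense set.
\<close>
lemma idem_times_eq_0_iff:
  "idem e * y = 0 \<longleftrightarrow> (\<forall>q. ultrafilter q \<longrightarrow> e \<in> q \<longrightarrow> L0_fun y q = 0)"
proof
  assume "idem e * y = 0"
  then show "\<forall>q. ultrafilter q \<longrightarrow> e \<in> q \<longrightarrow> L0_fun y q = 0"
    by (metis L0_fun_idem_times L0_fun_zero)
next
  assume "\<forall>q. ultrafilter q \<longrightarrow> e \<in> q \<longrightarrow> L0_fun y q = 0"
  then show "idem e * y = 0"
    by (intro L0_zeroI) (simp add: L0_fun_idem_times ultrafilter_finite_points)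
qed

lemma L0_nonzero_clopen:
  assumes "ultrafilter q" and "e \<in> q" and "L0_fun y q \<noteq> 0"
  shows "\<exists>f\<in>q. f \<le> e \<and> (\<forall>p. ultrafilter p \<longrightarrow> f \<in> p \<longrightarrow> L0_fun y p \<noteq> 0)"
proof -
  let ?W = "{p \<in> topspace stone_space. L0_fun y p \<in> - {0}}"
  have "openin stone_space ?W"
    by (rule openin_continuous_map_preimage[OF continuous_map_L0_fun]) auto
  moreover have "q \<in> ?W"
    using assms by (simp add: topspace_stone_space)
  ultimately obtain a where "a \<in> q" and "stone_clopen a \<subseteq> ?W"
    by (rule stone_space_clopen_base)
  then show ?thesis
    using assms by (intro bexI[of _ "inf a e"]) (auto simp: stone_clopen_def inf_mem_ultrafilter_iff)
qed

section \<open>Supports\<close>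

text \<open>
  If \<open>e y = 0\<close>, then \<open>e\<close> and \<open>f\<close> have no common point, and therefore \<open>inf e f = bot\<close> because nonzero
  elements lie in some ultrafilter. So \<open>f\<close> is disjoint from the supremum of all such \<open>e\<close>.
\<close>
lemma le_suppI:
  assumes "\<And>p. ultrafilter p \<Longrightarrow> f \<in> p \<Longrightarrow> L0_fun y p \<noteq> 0"
  shows "f \<le> supp y"
proof -
  have "e \<le> - f" if "idem e * y = 0" for e
  proof (rule ccontr)
    assume "\<not> e \<le> - f"
    then have "inf e f \<noteq> bot" by (simp add: inf_shunt)
    then obtain p where "ultrafilter p" "inf e f \<in> p" by (rule ultrafilter_exists)
    then show False
      using assms[of p] that unfolding idem_times_eq_0_iff by (auto simp: inf_mem_ultrafilter_iff)
  qed
  then have "Sup {e. idem e * y = 0} \<le> - f" by (intro Sup_least) blast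
  then show ?thesis
    by (simp add: supp_def diff_eq compl_le_swap1)
qed

lemma supp_le_compl: "idem e * y = 0 \<Longrightarrow> supp y \<le> - e"
  by (simp add: supp_def diff_eq Sup_upper)

lemma supp_meets_nonzero:
  assumes "inf f (supp y) \<noteq> bot"
  obtains q where "ultrafilter q" and "f \<in> q" and "L0_fun y q \<noteq> 0"
proof -
  have "idem f * y \<noteq> 0"
    using assms supp_le_compl by (metis inf_shunt inf.commute)
  then show ?thesis using that by (auto simp: idem_times_eq_0_iff)
qed

section \<open>Ideals and derivations\<close>

text \<open>
  The function \<open>1 / a\<close> on \<open>k\<close>, extended by zero, is continuous and finite, and its product with \<open>a\<close> is
  the characteristic function of \<open>k\<close>.
\<close>
lemma idem_in_ideal:
  fixes X :: "'b::{boolean_algebra, complete_lattice} L0 set"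
  assumes X: "ideal_in_CQ X" and a: "a \<in> X"
    and nz: "\<And>p. ultrafilter p \<Longrightarrow> k \<in> p \<Longrightarrow> L0_fun a p \<noteq> 0"
  shows "idem k \<in> X"
proof -
  have fin: "\<bar>L0_fun a p\<bar> \<noteq> \<infinity>" if "ultrafilter p" for p
  proof -
    have "a \<in> CQ" using X a unfolding ideal_in_CQ_def by blast
    then show ?thesis using that CQ_iff by metis
  qed
  let ?r = "\<lambda>t. ereal (inverse (real_of_ereal t))"
  have "continuous_on (UNIV - {\<infinity>, -\<infinity>, 0}) ?r"
    by (intro continuous_intros continuous_on_subset[OF continuous_on_real]) (auto simp: zero_ereal_def real_of_ereal_eq_0)
  moreover have "continuous_map (subtopology stone_space (stone_clopen k))
      (top_of_set (UNIV - {\<infinity>, -\<infinity>, 0})) (L0_fun a)"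
  proof -
    have "L0_fun a p \<in> UNIV - {\<infinity>, -\<infinity>, 0}" if "ultrafilter p" "k \<in> p" for p
      using fin[OF that(1)] nz[OF that] by auto
    then show ?thesis
      by (simp add: continuous_map_in_subtopology continuous_map_L0_fun
          continuous_map_from_subtopology stone_clopen_def topspace_stone_space image_subset_iff)
  qed
  ultimately have "continuous_map (subtopology stone_space (stone_clopen k)) euclidean
      (?r \<circ> L0_fun a)"
    by (intro continuous_map_compose) (auto simp: continuous_map_iff_continuous)
  then have "continuous_map stone_space euclidean (\<lambda>q. if k \<in> q then ?r (L0_fun a q) else 0)"
    unfolding comp_def by (rule continuous_map_extend_by_zero)
  then obtain b :: "'b L0" where b: "\<And>q. ultrafilter q \<Longrightarrow> L0_fun b q = (if k \<in> q then ?r (L0_fun a q) else 0)"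
    by (rule L0_obtain[where y = 0]) auto
  then have "b \<in> CQ"
    by (simp add: CQ_iff)
  moreover have "b * a = idem k"
  proof (rule L0_times_eqI)
    fix q assume "q \<in> finite_points a"
    then have q: "ultrafilter q" by (rule ultrafilter_finite_points)
    obtain r where r: "L0_fun a q = ereal r" using fin[OF q] by auto
    show "L0_fun (idem k) q = L0_fun b q * L0_fun a q"
      using nz[OF q] r by (auto simp: L0_fun_idem[OF q] b[OF q])
  qed
  ultimately show ?thesis
    using X a unfolding ideal_in_CQ_def by metis
qed

lemma idem_times_idem: "idem e * idem e = idem e"
  by (rule L0_times_eqI) (simp add: L0_fun_idem ultrafilter_finite_points)

text \<open>
  At an infinite value both sides are infinite, so the formula holds at every point.
\<close>
lemma L0_fun_add_self:
  assumes "ultrafilter q"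
  shows "L0_fun (w + w) q = 2 * L0_fun w q"
proof -
  have "continuous_map stone_space euclidean ((\<lambda>t::ereal. 2 * t) \<circ> L0_fun w)"
    by (rule continuous_map_compose[OF continuous_map_L0_fun])
      (auto simp: continuous_map_iff_continuous2 intro!: continuous_on_cmult_ereal continuous_on_id)
  then obtain z where z: "\<And>q. ultrafilter q \<Longrightarrow> L0_fun z q = ((\<lambda>t. 2 * t) \<circ> L0_fun w) q"
    by (rule L0_obtain[where y = w]) (auto simp: finite_points_iff)
  have "w + w = z"
  proof (rule L0_plus_eqI)
    fix q assume q: "q \<in> finite_points w"
    then obtain r where "L0_fun w q = ereal r" by (auto simp: finite_points_iff)
    then show "L0_fun z q = L0_fun w q + L0_fun w q"
      using q z by (simp add: ultrafilter_finite_points)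
  qed
  then show ?thesis
    using assms z by simp
qed

lemma derivation_on_zero:
  assumes "ideal_in_CQ X" and "derivation_on X \<delta>"
  shows "\<delta> 0 = 0"
proof -
  have zero: "0 *\<^sub>R u = 0" for u :: "'a L0"
    by (rule L0_scaleR_eqI) (simp add: L0_fun_zero ultrafilter_finite_points)
  have "0 \<in> X" using assms(1) by (simp add: ideal_in_CQ_def subalgebra_def)
  then have "\<delta> (0 *\<^sub>R 0) = 0 *\<^sub>R \<delta> 0"
    using assms(2) unfolding derivation_on_def by blast
  then show ?thesis by (simp add: zero)
qed

text \<open>
  Since \<open>k k = k\<close>, the Leibniz rule gives \<open>\<delta>(k) = 2 k \<delta>(k)\<close>. Off \<open>k\<close> this says \<open>\<delta>(k) = 0\<close>; on \<open>k\<close> it says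
  \<open>\<delta>(k) = 2 \<delta>(k)\<close>, which forces \<open>0\<close> at the points where \<open>\<delta>(k)\<close> is finite, and these are dense.
\<close>
lemma derivation_on_idem:
  assumes "derivation_on X \<delta>" and "idem k \<in> X"
  shows "\<delta> (idem k) = 0"
proof (rule L0_zeroI)
  fix q assume q: "q \<in> finite_points (\<delta> (idem k))"
  let ?w = "idem k * \<delta> (idem k)"
  have uq: "ultrafilter q" using q by (rule ultrafilter_finite_points)
  have "\<delta> (idem k) * idem k = ?w"
    by (rule L0_times_eqI)
      (simp add: L0_fun_idem_times L0_fun_idem ultrafilter_finite_points)
  moreover have "\<delta> (idem k * idem k) = \<delta> (idem k) * idem k + ?w"
    using assms unfolding derivation_on_def by blast
  ultimately have "\<delta> (idem k) = ?w + ?w" by (simp add: idem_times_idem)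
  then have "L0_fun (\<delta> (idem k)) q = 2 * L0_fun ?w q"
    using L0_fun_add_self[OF uq] by metis
  moreover have "L0_fun ?w q = (if k \<in> q then L0_fun (\<delta> (idem k)) q else 0)"
    by (rule L0_fun_idem_times[OF uq])
  moreover obtain r where r: "L0_fun (\<delta> (idem k)) q = ereal r"
    using q by (auto simp: finite_points_iff)
  ultimately have "ereal r = (if k \<in> q then 2 * ereal r else 0)"
    by (simp split: if_splits)
  then have "r = 0" by (simp split: if_splits)
  with r show "L0_fun (\<delta> (idem k)) q = 0" by simp
qed

text \<open>
  The Leibniz rule for \<open>k x = 0\<close>, where the term \<open>\<delta>(k) x\<close> drops out.
\<close>
lemma idem_times_derivation_eq_0:
  assumes X: "ideal_in_CQ X" and \<delta>: "derivation_on X \<delta>"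
    and k: "idem k \<in> X" and x: "x \<in> X" and kx: "idem k * x = 0"
  shows "idem k * \<delta> x = 0"
proof -
  have "\<delta> (idem k * x) = \<delta> (idem k) * x + idem k * \<delta> x"
    using \<delta> k x unfolding derivation_on_def by blast
  moreover have "0 * x = 0"
    by (rule L0_times_eqI) (simp add: L0_fun_zero ultrafilter_finite_points)
  moreover have "0 + y = y" for y :: "'a L0"
    by (rule L0_plus_eqI) (simp add: L0_fun_zero ultrafilter_finite_points)
  ultimately show ?thesis
    by (simp add: kx derivation_on_zero[OF X \<delta>] derivation_on_idem[OF \<delta> k])
qed

theorem theorem3p9:
  fixes X :: "'b::{boolean_algebra, complete_lattice} L0 set"
    and \<delta> :: "'b L0 \<Rightarrow> 'b L0"
  assumes "ideal_in_CQ X"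
    and "derivation_on X \<delta>"
  shows "band_preserving X \<delta> \<longleftrightarrow> supp_derivation X \<delta> \<le> supp_set X"
proof
  assume "band_preserving X \<delta>"
  then show "supp_derivation X \<delta> \<le> supp_set X"
    unfolding band_preserving_def supp_derivation_def supp_set_def
    by (intro Sup_least) (auto intro: Sup_upper2)
next
  assume le: "supp_derivation X \<delta> \<le> supp_set X"
  have "idem e * \<delta> x = 0" if x: "x \<in> X" and ex: "idem e * x = 0" for x e
  proof (rule ccontr)
    assume "idem e * \<delta> x \<noteq> 0"
    then obtain q where "ultrafilter q" "e \<in> q" "L0_fun (\<delta> x) q \<noteq> 0"
      by (auto simp: idem_times_eq_0_iff)
    then obtain f where f: "f \<in> q" "f \<le> e" "\<And>p. ultrafilter p \<Longrightarrow> f \<in> p \<Longrightarrow> L0_fun (\<delta> x) p \<noteq> 0"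
      using L0_nonzero_clopen by meson
    have "f \<le> supp (\<delta> x)" using f(3) by (rule le_suppI)
    also have "\<dots> \<le> supp_derivation X \<delta>"
      unfolding supp_derivation_def using x by (intro Sup_upper) blast
    also note le
    finally have fX: "f \<le> supp_set X" .
    have "\<exists>a\<in>X. inf f (supp a) \<noteq> bot"
    proof (rule ccontr)
      assume "\<not> (\<exists>a\<in>X. inf f (supp a) \<noteq> bot)"
      then have "supp a \<le> - f" if "a \<in> X" for a
        using that by (metis inf.commute inf_shunt)
      then have "supp_set X \<le> - f" unfolding supp_set_def by (auto intro: Sup_least)
      with fX have "f = bot" by (metis inf.orderE inf_shunt inf_idem order_trans)
      with f \<open>ultrafilter q\<close> show False by (simp add: bot_notin_ultrafilter)
    qed
    then obtain a where a: "a \<in> X" "inf f (supp a) \<noteq> bot" by blast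
    from a(2) obtain p where p: "ultrafilter p" "f \<in> p" "L0_fun a p \<noteq> 0"
      by (rule supp_meets_nonzero)
    then obtain k where k: "k \<in> p" "k \<le> f" "\<And>r. ultrafilter r \<Longrightarrow> k \<in> r \<Longrightarrow> L0_fun a r \<noteq> 0"
      using L0_nonzero_clopen by meson
    have "idem k \<in> X" using assms(1) a(1) k(3) by (rule idem_in_ideal)
    moreover have "idem k * x = 0"
      using ex f(2) k(2) by (meson idem_times_eq_0_iff ultrafilter_mono)
    ultimately have "idem k * \<delta> x = 0"
      using idem_times_derivation_eq_0 assms x by blast
    then show False
      using k(1) p(1) f(3)[OF p(1,2)] unfolding idem_times_eq_0_iff by blast
  qed
  then have "{e. idem e * x = 0} \<subseteq> {e. idem e * \<delta> x = 0}" if "x \<in> X" for x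
    using that by blast
  then show "band_preserving X \<delta>"
    unfolding band_preserving_def supp_def
    by (auto simp: diff_eq intro!: Sup_subset_mono)
qed

end
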